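(* Let $p\neq 2,5$ be a prime and let $a$ be a positive integer. Then $$\sum_{k=0}^{p^a-1}\binom{p^a-1}{k}\binom{2k}{k}\equiv\left(\frac{p^a}{5}\right)\left(5^{p-1}-3F_{p-\left(\frac p5\right)}\right)\pmod{p^2}$$ and $$\sum_{k=0}^{p^a-1}\binom{p^a-1}{k}\frac{\binom{2k}{k}}{(-5)^k}\equiv\left(\frac{p^a}{5}\right)\left(1-3F_{p-\left(\frac p5\right)}\right)\pmod{p^2},$$ where $\{F_n\}_{n\geq 0}$ is the Fibonacci sequence defined by $F_0=0$, $F_1=1$, and $F_{n+1}=F_n+F_{n-1}$ for $n=1,2,3,\ldots$.
   Context: Congruences modulo $p^2$ between rational numbers with denominators prime to $p$ are taken in the ring $\mathbb{Z}_p$ of $p$-adic integers. $(-)$ denotes the Jacobi symbol. *)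

theory Defs
  imports "HOL-Number_Theory.Number_Theory"
begin

text \<open>
  The Jacobi symbol \<open>(a / n)\<close> for odd positive \<open>n\<close>: the product of the Legendre symbols
  over the prime factors of \<open>n\<close>, counted with multiplicity.
\<close>

definition jacobi :: "int \<Rightarrow> nat \<Rightarrow> int" where
  "jacobi a n = (\<Prod>q\<in>#prime_factorization n. Legendre a (int q))"

lemma jacobi_prime: "prime q \<Longrightarrow> jacobi a q = Legendre a (int q)"
  by (simp add: jacobi_def prime_factorization_prime)

definition p_integral :: "nat \<Rightarrow> rat \<Rightarrow> bool" where
  "p_integral p x \<longleftrightarrow> coprime (snd (quotient_of x)) (int p)"

text \<open>
  Congruence modulo \<open>m\<close> in the ring of \<open>p\<close>-adic integers, restricted to rational
  arguments. Both arguments must lie in the ring. The cofactor \<open>z\<close> can be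
  taken rational: for \<open>m > 0\<close> it equals \<open>(x - y) / m\<close>, and a rational number is a
  \<open>p\<close>-adic integer iff its reduced denominator is prime to \<open>p\<close>.
\<close>

definition padic_cong :: "nat \<Rightarrow> rat \<Rightarrow> rat \<Rightarrow> nat \<Rightarrow> bool" where
  "padic_cong p x y m \<longleftrightarrow>
     p_integral p x \<and> p_integral p y \<and> (\<exists>z. p_integral p z \<and> x - y = of_nat m * z)"

lemma p_integral_of_int [simp]: "p_integral p (of_int a)"
  by (simp add: p_integral_def)

lemma padic_cong_of_int_iff:
  fixes p n :: nat and a b :: int
  shows "padic_cong p (of_int a) (of_int b) (p ^ n) \<longleftrightarrow> [a = b] (mod int p ^ n)"
proof
  assume "padic_cong p (of_int a) (of_int b) (p ^ n)"
  then obtain z where z: "p_integral p z" "of_int a - of_int b = of_nat (p ^ n) * z"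
    by (auto simp: padic_cong_def)
  obtain u v where uv: "quotient_of z = (u, v)" by fastforce
  have v: "v > 0" "z = of_int u / of_int v" "coprime v (int p)"
    using uv z(1) quotient_of_denom_pos quotient_of_div by (auto simp: p_integral_def)
  have "(of_int ((a - b) * v) :: rat) = of_int (int p ^ n * u)"
    using z(2) v by (simp add: field_simps)
  then have "(a - b) * v = int p ^ n * u"
    by (simp only: of_int_eq_iff)
  then have "int p ^ n dvd (a - b) * v" by simp
  moreover have "coprime (int p ^ n) v"
    using v(3) by (simp add: coprime_commute)
  ultimately show "[a = b] (mod int p ^ n)"
    by (simp add: cong_iff_dvd_diff coprime_dvd_mult_left_iff)
next
  assume "[a = b] (mod int p ^ n)"
  then obtain k where "a - b = int p ^ n * k"
    by (auto simp: cong_iff_dvd_diff)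
  then have "(of_int (a - b) :: rat) = of_int (int p ^ n * k)" by simp
  then show "padic_cong p (of_int a) (of_int b) (p ^ n)"
    unfolding padic_cong_def by (auto intro!: exI[of _ "of_int k"])
qed

end

theory Submission
  imports Defs "HOL-Computational_Algebra.Polynomial"
begin

text \<open>
  Put \<open>q = p\<^sup>a\<close> and \<open>n = q - 1\<close>. As \<open>t\<^sup>2 + 3t + 1 = (t + 1)\<^sup>2 + t = (t - 1)\<^sup>2 + 5t\<close>,
  both sums come from the coefficient \<open>T\<close> of \<open>t\<^sup>n\<close> in \<open>(t\<^sup>2 + 3t + 1)\<^sup>n\<close>: the first
  equals \<open>T\<close> and the second \<open>T / 5\<^sup>n\<close>. Over \<open>\<int>[\<phi>]\<close>, with \<open>s\<close> the square root of 5,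
  the quadratic is \<open>(t + \<beta>) (t + \<beta> + s)\<close> with \<open>\<beta> = 2 - \<phi>\<close>, which gives
  \<open>T = \<Sum>\<^sub>k C(n, k) C(n + k, k) \<beta>\<^sup>k s\<^bsup>n-k\<^esup>\<close>. For \<open>0 < k < q\<close> the product of binomial
  coefficients is congruent to \<open>- C(q, k)\<close> modulo \<open>p\<^sup>2\<close>, so the binomial theorem yields
  \<open>s T \<equiv> 2 s\<^sup>q - ((\<beta> + s)\<^sup>q - \<beta>\<^sup>q)\<close>, that is \<open>T \<equiv> 2 \<cdot> 5\<^bsup>n/2\<^esup> - F\<^bsub>2q\<^esub>\<close>. Frobenius on
  \<open>\<int>[\<phi>]\<close> modulo \<open>p\<close>, raised to \<open>p\<close>-th powers, reduces the right-hand side to \<open>a = 1\<close>,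
  where Cassini's identity evaluates \<open>F\<^bsub>2p\<^esub>\<close>.
\<close>

section \<open>Central coefficients of powers of quadratic polynomials\<close>

lemma coeff_linear_pow:
  fixes c :: "'a::comm_ring_1"
  shows "coeff ([:c, 1:] ^ m) k = of_nat (m choose k) * c ^ (m - k)"
proof (cases "k \<le> m")
  case True
  then show ?thesis by (simp add: coeff_linear_poly_power)
next
  case False
  then show ?thesis
    by (simp add: binomial_eq_0 coeff_eq_0 degree_linear_power)
qed

text \<open>Expanding in powers of \<open>(t + c)^2\<close> and \<open>d t\<close>, the k-th summand
  needs the coefficient of \<open>t^k\<close> in \<open>(t + c)^(2k)\<close>. The cases
  \<open>c = d = 1\<close> and \<open>c = -1\<close>, \<open>d = 5\<close> lead to the two sums of
  the theorem.\<close>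

lemma coeff_shifted_square_pow:
  fixes c d :: "'a::comm_ring_1"
  shows "coeff (([:c, 1:] ^ 2 + monom d 1) ^ n) n
    = (\<Sum>k\<le>n. of_nat (n choose k) * of_nat ((2 * k) choose k) * c ^ k * d ^ (n - k))"
proof -
  have "coeff (([:c, 1:] ^ 2 + monom d 1) ^ n) n
      = (\<Sum>k\<le>n. of_nat (n choose k) * coeff ([:c, 1:] ^ (2 * k) * monom d 1 ^ (n - k)) n)"
    by (simp add: binomial_ring coeff_sum power_mult mult.assoc of_nat_poly)
  also have "\<dots> = (\<Sum>k\<le>n. of_nat (n choose k) * of_nat ((2 * k) choose k) * c ^ k * d ^ (n - k))"
    by (intro sum.cong refl)
       (simp add: monom_power mult.commute[of _ "monom _ _"] coeff_monom_mult coeff_linear_pow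
         mult_ac flip: mult_2)
  finally show ?thesis .
qed

text \<open>Writing the second factor as \<open>(t + b) + s\<close> and expanding only its power
  leaves the pure powers \<open>(t + b)^(n + k)\<close>.\<close>

lemma coeff_product_pow:
  fixes b s :: "'a::comm_ring_1"
  shows "coeff (([:b, 1:] * [:b + s, 1:]) ^ n) n
    = (\<Sum>k\<le>n. of_nat (n choose k) * of_nat ((n + k) choose k) * b ^ k * s ^ (n - k))"
proof -
  have "[:b + s, 1:] = [:b, 1:] + [:s:]" by simp
  then have "([:b, 1:] * [:b + s, 1:]) ^ n = [:b, 1:] ^ n * ([:b, 1:] + [:s:]) ^ n"
    by (simp only: power_mult_distrib)
  also have "\<dots> = (\<Sum>k\<le>n. smult (of_nat (n choose k) * s ^ (n - k)) ([:b, 1:] ^ (n + k)))"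
    unfolding binomial_ring
    by (simp add: sum_distrib_left power_add poly_const_pow of_nat_poly mult_ac)
  finally have "coeff (([:b, 1:] * [:b + s, 1:]) ^ n) n
      = (\<Sum>k\<le>n. of_nat (n choose k) * (s ^ (n - k) * coeff ([:b, 1:] ^ (n + k)) n))"
    by (simp only: coeff_sum coeff_smult mult.assoc)
  also have "\<dots> = (\<Sum>k\<le>n. of_nat (n choose k) * of_nat ((n + k) choose k) * b ^ k * s ^ (n - k))"
  proof (intro sum.cong refl)
    fix k
    have "(n + k) choose n = (n + k) choose k"
      using binomial_symmetric[of n "n + k"] by simp
    then show "of_nat (n choose k) * (s ^ (n - k) * coeff ([:b, 1:] ^ (n + k)) n)
      = of_nat (n choose k) * of_nat ((n + k) choose k) * b ^ k * s ^ (n - k)"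
      by (simp add: coeff_linear_pow mult_ac)
  qed
  finally show ?thesis .
qed

text \<open>The assumptions match the linear and constant coefficients of the monic quadratics
  behind the two preceding expansions.\<close>

lemma binomial_sum_legendre_form:
  fixes b s c d :: "'a::comm_ring_1"
  assumes "2 * b + s = 2 * c + d" and "b * (b + s) = c\<^sup>2"
  shows "(\<Sum>k\<le>n. of_nat (n choose k) * of_nat ((2 * k) choose k) * c ^ k * d ^ (n - k))
    = (\<Sum>k\<le>n. of_nat (n choose k) * of_nat ((n + k) choose k) * b ^ k * s ^ (n - k))"
proof -
  have "[:c, 1:] ^ 2 + monom d 1 = [:b, 1:] * [:b + s, 1:]"
    using assms by (simp add: power2_eq_square monom_altdef algebra_simps mult_2)
  then show ?thesis
    using coeff_shifted_square_pow[of c d n] coeff_product_pow[of b s n] by argo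
qed

section \<open>Binomial coefficients of prime powers modulo p and p^2\<close>

lemma prime_dvd_choose_prime_power:
  fixes p a j :: nat
  assumes "prime p" "0 < j" "j < p ^ a"
  shows "p dvd (p ^ a choose j)"
proof (rule ccontr)
  assume "\<not> p dvd (p ^ a choose j)"
  then have "coprime (p ^ a) (p ^ a choose j)"
    using assms(1) by (simp add: prime_imp_coprime)
  moreover have "j * (p ^ a choose j) = p ^ a * (p ^ a - 1 choose (j - 1))"
    using assms(2) by (rule times_binomial_minus1_eq)
  ultimately have "p ^ a dvd j"
    by (metis coprime_dvd_mult_left_iff dvd_triv_left)
  then show False
    using assms by (simp add: nat_dvd_not_less)
qed

text \<open>In Vandermonde's convolution every term except j = 0 contains some
  \<open>p^a choose j\<close> with 0 < j < p^a.\<close>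

lemma choose_prime_power_add_cong:
  fixes p a k m :: nat
  assumes "prime p" "k < p ^ a"
  shows "[p ^ a + m choose k = m choose k] (mod p)"
proof -
  have "p ^ a + m choose k = (\<Sum>j\<le>k. (p ^ a choose j) * (m choose (k - j)))"
    by (rule vandermonde[symmetric])
  also have "{..k} = insert 0 {1..k}" by auto
  also have "(\<Sum>j\<in>insert 0 {1..k}. (p ^ a choose j) * (m choose (k - j)))
      = (m choose k) + (\<Sum>j=1..k. (p ^ a choose j) * (m choose (k - j)))"
    by simp
  finally have eq: "p ^ a + m choose k = (m choose k) + (\<Sum>j=1..k. (p ^ a choose j) * (m choose (k - j)))" .
  have "p dvd (\<Sum>j=1..k. (p ^ a choose j) * (m choose (k - j)))"
    using assms by (intro dvd_sum dvd_mult2 prime_dvd_choose_prime_power) auto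
  then show ?thesis
    unfolding eq by (simp add: cong_altdef_nat)
qed

text \<open>Absorption and Pascal's rule turn the sum into \<open>C * (D - (E - 1))\<close>. One
  factor p comes from C, the other from D being 0 and E being 1 modulo p.\<close>

lemma choose_mult_choose_prime_power:
  fixes p a k :: nat
  assumes p: "prime p" and k: "0 < k" "k < p ^ a"
  shows "int p ^ 2 dvd int ((p ^ a - 1 choose k) * (p ^ a - 1 + k choose k)) + int (p ^ a choose k)"
proof -
  define q where "q = p ^ a"
  define A B C D E where "A = int (q - 1 choose (k - 1))" and "B = int (q - 1 choose k)"
    and "C = int (q choose k)" and "D = int (q - 1 + k choose k)"
    and "E = int (q - 1 + k choose (k - 1))"
  have q: "k < q" using k by (simp add: q_def)
  obtain j where j: "k = Suc j" using k by (cases k) auto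
  obtain n where n: "q = Suc n" using q by (cases q) auto
  have C: "C = A + B"
    unfolding A_def B_def C_def by (simp add: n j)
  have kC: "int k * C = int q * A"
    unfolding A_def C_def using times_binomial_minus1_eq[OF k(1), of q]
    by (simp only: flip: of_nat_mult)
  have kD: "int k * D = int q * E"
  proof -
    have "k * (q - 1 + k choose k) = q * (q - 1 + k choose (k - 1))"
      using Suc_times_binomial_add[of j n] by (simp add: n j add.commute)
    then show ?thesis unfolding D_def E_def by (metis of_nat_mult)
  qed
  have "int k * (D * A) = int k * (E * C)"
    using kC kD by (simp add: algebra_simps)
  then have DA: "D * A = E * C" using k by simp
  have eq: "B * D + C = C * (D - (E - 1))"
    using DA C by (simp add: algebra_simps)
  have "p dvd (q choose k)"
    unfolding q_def using assms by (intro prime_dvd_choose_prime_power) auto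
  then have "int p dvd C" by (simp add: C_def)
  \<comment> \<open>Grouping \<open>q - 1 + k\<close> as \<open>q + (k - 1)\<close> reduces the
    upper entry to \<open>k - 1\<close>, just below k.\<close>
  have "[q + (k - 1) choose k = k - 1 choose k] (mod p)"
    "[q + (k - 1) choose (k - 1) = k - 1 choose (k - 1)] (mod p)"
    unfolding q_def using assms by (intro choose_prime_power_add_cong; simp)+
  then have "[q - 1 + k choose k = 0] (mod p)" "[q - 1 + k choose (k - 1) = 1] (mod p)"
    using k n by (simp_all add: binomial_eq_0)
  then have "[D = 0] (mod int p)" "[E = 1] (mod int p)"
    unfolding D_def E_def by (metis cong_int_iff of_nat_0 of_nat_1)+
  then have "int p dvd D - (E - 1)"
    by (auto simp: cong_0_iff cong_iff_dvd_diff)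
  with \<open>int p dvd C\<close> have "int p * int p dvd C * (D - (E - 1))"
    by (rule mult_dvd_mono)
  then show ?thesis
    unfolding eq[symmetric] by (simp add: B_def C_def D_def q_def power2_eq_square)
qed

section \<open>The ring Z[phi] and its link to Fibonacci numbers\<close>

text \<open>\<open>Golden a b\<close> stands for \<open>a + b \<phi>\<close> with \<open>\<phi>\<^sup>2 = \<phi> + 1\<close>.\<close>

datatype golden = Golden int int

instantiation golden :: comm_ring_1
begin

definition "0 = Golden 0 0"
definition "1 = Golden 1 0"
fun plus_golden where "Golden a b + Golden c d = Golden (a + c) (b + d)"
fun minus_golden where "Golden a b - Golden c d = Golden (a - c) (b - d)"
fun uminus_golden where "- Golden a b = Golden (- a) (- b)"
fun times_golden where
  "Golden a b * Golden c d = Golden (a * c + b * d) (a * d + b * c + b * d)"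

instance
proof
  fix x y z :: golden
  show "x * y * z = x * (y * z)" "(x + y) * z = x * z + y * z" "x + y + z = x + (y + z)"
    by (cases x; cases y; cases z; simp add: algebra_simps)+
  show "x * y = y * x" "x + y = y + x" "x - y = x + - y"
    by (cases x; cases y; simp add: algebra_simps)+
  show "0 + x = x" "- x + x = 0" "1 * x = x" "(0::golden) \<noteq> 1"
    by (cases x; simp add: zero_golden_def one_golden_def)+
qed

end

lemma of_nat_golden: "of_nat n = Golden (int n) 0"
  by (induction n) (simp_all add: zero_golden_def one_golden_def)

lemma of_int_golden: "of_int n = Golden n 0"
  by (cases n) (simp_all add: of_nat_golden one_golden_def)

lemma numeral_golden: "numeral w = Golden (numeral w) 0"
  using of_int_golden[of "numeral w"] by simp

text \<open>Since 1 and \<open>phi\<close> form an integral basis, divisibility by an integer is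
  tested on coordinates. This brings congruences in Z[phi] back to the integers.\<close>

lemma of_int_dvd_golden_iff: "of_int m dvd Golden a b \<longleftrightarrow> m dvd a \<and> m dvd b"
proof
  assume "of_int m dvd Golden a b"
  then obtain z where "Golden a b = of_int m * z" by (auto elim: dvdE)
  then show "m dvd a \<and> m dvd b" by (cases z) (simp add: of_int_golden)
next
  assume "m dvd a \<and> m dvd b"
  then obtain c d where "a = m * c" "b = m * d" by (auto elim!: dvdE)
  then have "Golden a b = of_int m * Golden c d" by (simp add: of_int_golden)
  then show "of_int m dvd Golden a b" by simp
qed

lemma of_int_dvd_of_int_golden_iff: "(of_int m :: golden) dvd of_int n \<longleftrightarrow> m dvd n"
  by (simp add: of_int_golden[of n] of_int_dvd_golden_iff)

definition phi :: golden where "phi = Golden 0 1"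
definition phi_conj :: golden where "phi_conj = Golden 1 (- 1)"
definition sqrt5 :: golden where "sqrt5 = Golden (- 1) 2"

lemma sqrt5_squared: "sqrt5 * sqrt5 = 5"
  by (simp add: sqrt5_def numeral_golden)

lemma sqrt5_power_odd: "odd m \<Longrightarrow> sqrt5 ^ m = 5 ^ ((m - 1) div 2) * sqrt5"
  by (erule oddE) (simp add: power_mult power2_eq_square sqrt5_squared)

text \<open>The first coordinate is F_(n-1), written as a difference so that n = 0 is
  covered.\<close>

lemma phi_power: "phi ^ n = Golden (int (fib (Suc n)) - int (fib n)) (int (fib n))"
  by (induction n) (simp_all add: one_golden_def phi_def)

lemma phi_conj_power: "phi_conj ^ n = Golden (int (fib (Suc n))) (- int (fib n))"
  by (induction n) (simp_all add: one_golden_def phi_conj_def)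

lemma phi_power_diff: "phi ^ n - phi_conj ^ n = of_int (int (fib n)) * sqrt5"
  by (simp add: phi_power phi_conj_power sqrt5_def of_int_golden)

text \<open>The coordinates of \<open>n * sqrt5\<close> are -n and 2n. This is how the factor
  \<open>sqrt5\<close> is finally cancelled.\<close>

lemma of_int_dvd_mult_sqrt5_iff:
  assumes "coprime m (5::int)"
  shows "of_int m dvd of_int n * sqrt5 \<longleftrightarrow> m dvd n"
  using assms by (auto simp: sqrt5_def of_int_golden[of n] of_int_dvd_golden_iff)

section \<open>Congruences between p-th powers in commutative rings\<close>

lemma prime_dvd_power_add:
  fixes x y :: "'a::comm_ring_1"
  assumes "prime p"
  shows "of_nat p dvd (x + y) ^ p - (x ^ p + y ^ p)"
proof -
  have p: "p > 0" using assms by (rule prime_gt_0_nat)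
  have "(x + y) ^ p = (\<Sum>k\<in>{..p}. of_nat (p choose k) * x ^ k * y ^ (p - k))"
    by (rule binomial_ring)
  also have "{..p} = insert 0 (insert p {0<..<p})" by auto
  also have "(\<Sum>k\<in>\<dots>. of_nat (p choose k) * x ^ k * y ^ (p - k))
      = x ^ p + y ^ p + (\<Sum>k\<in>{0<..<p}. of_nat (p choose k) * x ^ k * y ^ (p - k))"
    using p by simp
  finally have "(x + y) ^ p - (x ^ p + y ^ p)
      = (\<Sum>k\<in>{0<..<p}. of_nat (p choose k) * x ^ k * y ^ (p - k))"
    by simp
  also have "of_nat p dvd \<dots>"
  proof (intro dvd_sum dvd_mult2)
    fix k assume "k \<in> {0<..<p}"
    then have "p dvd (p choose k)" using assms by (intro dvd_choose_prime) auto
    then show "of_nat p dvd (of_nat (p choose k) :: 'a)"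
      by (auto elim!: dvdE)
  qed
  finally show ?thesis .
qed

lemma dvd_power_diff: 
  fixes x y :: "'a::comm_ring_1"
  assumes "m dvd x - y"
  shows "m dvd x ^ n - y ^ n"
  by (subst power_diff_sumr2) (rule dvd_mult2[OF assms])

text \<open>The cofactor of \<open>x - y\<close> in \<open>x^p - y^p\<close> is a sum of p terms,
  each congruent to \<open>y^(p-1)\<close> modulo p, so it supplies a second factor p.\<close>

lemma dvd_power_diff_lift:
  fixes x y :: "'a::comm_ring_1"
  assumes "of_nat p dvd x - y"
  shows "of_nat p ^ 2 dvd x ^ p - y ^ p"
proof -
  have "of_nat p dvd (\<Sum>i<p. y ^ (p - Suc i) * x ^ i)"
  proof -
    have *: "of_nat p dvd (\<Sum>i<p. y ^ (p - Suc i) * (x ^ i - y ^ i))"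
      using assms by (intro dvd_sum dvd_mult dvd_power_diff)
    have "(\<Sum>i<p. y ^ (p - Suc i) * y ^ i) = (\<Sum>i<p. y ^ (p - 1))"
      by (intro sum.cong refl) (simp flip: power_add)
    then have "(\<Sum>i<p. y ^ (p - Suc i) * x ^ i)
        = (\<Sum>i<p. y ^ (p - Suc i) * (x ^ i - y ^ i)) + of_nat p * y ^ (p - 1)"
      by (simp add: right_diff_distrib sum_subtractf)
    then show ?thesis using dvd_add[OF * dvd_triv_left] by simp
  qed
  then show ?thesis
    by (subst power_diff_sumr2, subst power2_eq_square) (rule mult_dvd_mono[OF assms])
qed

text \<open>One p-th power, available because a > 0, lifts the congruence to p^2; the further powers
  keep that modulus.\<close>

lemma dvd_power_prime_power_diff:
  fixes x y :: "'a::comm_ring_1"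
  assumes "of_nat p dvd x ^ p - y" and "a > 0"
  shows "of_nat p ^ 2 dvd x ^ (p ^ Suc a) - y ^ (p ^ a)"
proof -
  obtain b where a: "a = Suc b" using assms(2) by (cases a) auto
  have "of_nat p ^ 2 dvd ((x ^ p) ^ p) ^ (p ^ b) - (y ^ p) ^ (p ^ b)"
    using assms(1) by (intro dvd_power_diff[of _ _ _ "p ^ b"] dvd_power_diff_lift)
  then show ?thesis by (simp only: a power_Suc flip: power_mult mult.assoc)
qed

lemma of_nat_dvd_golden: "int m dvd n \<Longrightarrow> (of_nat m :: golden) dvd of_int n"
  using of_int_dvd_of_int_golden_iff[of "int m" n] by simp

section \<open>The first sum in terms of powers of phi\<close>

text \<open>The factor \<open>sqrt5\<close> raises the exponent n - k to q - k. Once the binomial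
  products are replaced by \<open>- (q choose k)\<close>, the terms with 0 < k < q are, up to sign,
  those of \<open>(b + sqrt5)^q\<close>.\<close>

lemma sqrt5_mult_binomial_sum_cong:
  fixes p a :: nat
  assumes p: "prime p"
  defines "q \<equiv> p ^ a"
  shows "of_nat p ^ 2 dvd sqrt5 * (\<Sum>k\<le>q - 1. of_nat (q - 1 choose k) * of_nat (2 * k choose k))
    - (2 * sqrt5 ^ q - ((phi ^ 2) ^ q - (phi_conj ^ 2) ^ q))"
proof -
  define n where "n = q - 1"
  have q: "q = Suc n" using prime_gt_0_nat[OF p] by (simp add: n_def q_def)
  \<comment> \<open>\<open>phi_conj^2\<close> and \<open>phi^2\<close> have sum 3 and product 1, so
    \<open>t^2 + 3t + 1\<close> is \<open>(t + b) (t + b + sqrt5)\<close>.\<close>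
  define b where "b = phi_conj ^ 2"
  have b: "b + sqrt5 = phi ^ 2" "b * (b + sqrt5) = 1\<^sup>2" "2 * b + sqrt5 = 2 * 1 + 1"
    by (simp_all add: b_def phi_conj_def sqrt5_def phi_def power2_eq_square one_golden_def numeral_golden)
  have "sqrt5 * (\<Sum>k\<le>n. of_nat (n choose k) * of_nat (2 * k choose k))
      = sqrt5 * (\<Sum>k\<le>n. of_nat (n choose k) * of_nat (n + k choose k) * b ^ k * sqrt5 ^ (n - k))"
    using binomial_sum_legendre_form[OF b(3,2), of n] by simp
  also have "\<dots> = (\<Sum>k\<in>{..n}. of_nat ((n choose k) * (n + k choose k)) * (b ^ k * sqrt5 ^ (q - k)))"
    unfolding sum_distrib_left by (intro sum.cong refl) (simp add: q Suc_diff_le mult_ac)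
  \<comment> \<open>The term k = 0 is split off: its coefficient is 1 instead of -1, whence the 2 in
    \<open>2 * sqrt5^q\<close>.\<close>
  also have "\<dots> = sqrt5 ^ q
      + (\<Sum>k=1..n. of_nat ((n choose k) * (n + k choose k)) * (b ^ k * sqrt5 ^ (q - k)))"
  proof -
    have "{..n} = insert 0 {1..n}" by auto
    then show ?thesis by simp
  qed
  finally have T: "sqrt5 * (\<Sum>k\<le>n. of_nat (n choose k) * of_nat (2 * k choose k))
      = sqrt5 ^ q + (\<Sum>k=1..n. of_nat ((n choose k) * (n + k choose k)) * (b ^ k * sqrt5 ^ (q - k)))" .
  have "(phi ^ 2) ^ q = (\<Sum>k\<in>{..q}. of_nat (q choose k) * (b ^ k * sqrt5 ^ (q - k)))"
    unfolding b(1)[symmetric] binomial_ring by (simp only: mult.assoc)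
  also have "{..q} = insert 0 (insert q {1..n})" by (auto simp: q)
  finally have "(phi ^ 2) ^ q
      = sqrt5 ^ q + b ^ q + (\<Sum>k=1..n. of_nat (q choose k) * (b ^ k * sqrt5 ^ (q - k)))"
    by (simp add: q)
  with T have eq: "sqrt5 * (\<Sum>k\<le>n. of_nat (n choose k) * of_nat (2 * k choose k))
        - (2 * sqrt5 ^ q - ((phi ^ 2) ^ q - b ^ q))
      = (\<Sum>k=1..n. of_int (int ((n choose k) * (n + k choose k)) + int (q choose k))
          * (b ^ k * sqrt5 ^ (q - k)))"
    by (simp add: sum.distrib algebra_simps)
  have "of_nat p ^ 2 dvd (\<Sum>k=1..n. of_int (int ((n choose k) * (n + k choose k)) + int (q choose k))
          * (b ^ k * sqrt5 ^ (q - k)))"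
  proof (intro dvd_sum dvd_mult2)
    fix k assume "k \<in> {1..n}"
    then have "int p ^ 2 dvd int ((n choose k) * (n + k choose k)) + int (q choose k)"
      using choose_mult_choose_prime_power[OF p, of k a] q by (simp add: q_def n_def)
    then show "(of_nat p ^ 2 :: golden)
        dvd of_int (int ((n choose k) * (n + k choose k)) + int (q choose k))"
      unfolding of_nat_power[symmetric] by (intro of_nat_dvd_golden) simp
  qed
  then show ?thesis unfolding eq[symmetric] by (simp add: n_def b_def)
qed

section \<open>Frobenius on Z[phi] and Fibonacci numbers at primes\<close>

text \<open>Modulo p, \<open>(2 * phi)^p = (1 + sqrt5)^p\<close> is \<open>1 + sqrt5^p\<close>, and
  \<open>sqrt5^p\<close> is \<open>e * sqrt5\<close>; the claims follow by comparing
  coordinates.\<close>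

lemma fib_prime_cong:
  fixes e :: int
  assumes p: "prime p" "odd p" and e: "[5 ^ ((p - 1) div 2) = e] (mod int p)"
  shows "[int (fib p) = e] (mod int p)" and "[2 * int (fib (Suc p)) = 1 + e] (mod int p)"
proof -
  have "of_nat p dvd (1 + sqrt5) ^ p - (1 ^ p + sqrt5 ^ p)"
    using p(1) by (rule prime_dvd_power_add)
  also have "1 + sqrt5 = 2 * phi"
    by (simp add: sqrt5_def phi_def one_golden_def numeral_golden)
  finally have 1: "of_nat p dvd 2 ^ p * phi ^ p - (1 + 5 ^ ((p - 1) div 2) * sqrt5)"
    by (simp add: power_mult_distrib sqrt5_power_odd[OF p(2)])
  \<comment> \<open>Fermat's theorem replaces the factor \<open>2^p\<close> of \<open>phi^p\<close>
    by 2.\<close>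
  have "[2 ^ (p - 1) = 1] (mod p)"
    using p primes_dvd_imp_eq[OF p(1) two_is_prime_nat] by (intro fermat_theorem) auto
  then have "[2 * 2 ^ (p - 1) = 2 * 1] (mod p)" by (rule cong_scalar_left)
  then have "[2 ^ p = 2] (mod p)"
    using prime_gt_0_nat[OF p(1)] by (simp add: power_eq_if)
  then have "int p dvd 2 ^ p - 2"
    using cong_int_iff[of "2 ^ p" 2 p] by (simp add: cong_iff_dvd_diff)
  then have 2: "of_nat p dvd (2 ^ p - 2) * phi ^ p"
    using of_nat_dvd_golden[of p "2 ^ p - 2"] by simp
  have "int p dvd 5 ^ ((p - 1) div 2) - e"
    using e by (simp add: cong_iff_dvd_diff)
  then have 3: "of_nat p dvd (5 ^ ((p - 1) div 2) - of_int e) * sqrt5"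
    using of_nat_dvd_golden[of p "5 ^ ((p - 1) div 2) - e"] by simp
  have "of_nat p dvd 2 * phi ^ p - (1 + of_int e * sqrt5)"
    using dvd_add[OF dvd_diff[OF 1 2] 3] by (simp add: algebra_simps)
  moreover have "2 * phi ^ p - (1 + of_int e * sqrt5)
    = Golden (2 * int (fib (Suc p)) - 2 * int (fib p) - 1 + e) (2 * (int (fib p) - e))"
    by (simp add: phi_power sqrt5_def of_int_golden one_golden_def numeral_golden algebra_simps)
  ultimately have *: "int p dvd 2 * int (fib (Suc p)) - 2 * int (fib p) - 1 + e"
      "int p dvd 2 * (int (fib p) - e)"
    using of_int_dvd_golden_iff[of "int p"] by simp_all
  have "coprime (int p) 2" by (simp add: p(2) coprime_commute)
  then have "int p dvd int (fib p) - e"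
    using *(2) coprime_dvd_mult_right_iff by blast
  then show "[int (fib p) = e] (mod int p)"
    by (simp add: cong_iff_dvd_diff)
  show "[2 * int (fib (Suc p)) = 1 + e] (mod int p)"
    using dvd_add[OF *] by (simp add: cong_iff_dvd_diff algebra_simps)
qed

text \<open>Modulo p, F_p is e and F_(p+1) is (1 + e)/2, that is 1 or 0. Hence Frobenius fixes
  \<open>phi\<close> and \<open>phi_conj\<close> for e = 1 and swaps them for e = -1.\<close>

lemma golden_frobenius:
  assumes p: "prime p" "odd p" and e: "[5 ^ ((p - 1) div 2) = e] (mod int p)" "e \<in> {1, -1}"
  shows "of_nat p dvd sqrt5 ^ p - of_int e * sqrt5"
    and "of_nat p dvd phi ^ p - (if e = 1 then phi else phi_conj)"
    and "of_nat p dvd phi_conj ^ p - (if e = 1 then phi_conj else phi)"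
proof -
  have c: "coprime (int p) 2" by (simp add: p(2) coprime_commute)
  have "of_nat p dvd of_int (5 ^ ((p - 1) div 2) - e) * sqrt5"
    using e(1) by (intro dvd_mult2 of_nat_dvd_golden) (simp add: cong_iff_dvd_diff)
  then show "of_nat p dvd sqrt5 ^ p - of_int e * sqrt5"
    by (simp add: sqrt5_power_odd[OF p(2)] left_diff_distrib)
  have 1: "int p dvd int (fib p) - e"
    using fib_prime_cong(1)[OF p e(1)] by (simp add: cong_iff_dvd_diff)
  have 2: "int p dvd int (fib (Suc p)) - (if e = 1 then 1 else 0)"
  proof -
    have "int p dvd 2 * (int (fib (Suc p)) - (if e = 1 then 1 else 0))"
      using fib_prime_cong(2)[OF p e(1)] e(2) by (auto simp: cong_iff_dvd_diff)
    then show ?thesis using c coprime_dvd_mult_right_iff by blast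
  qed
  show "of_nat p dvd phi ^ p - (if e = 1 then phi else phi_conj)"
    unfolding phi_power using 1 2 dvd_diff[OF 2 1] e(2) of_int_dvd_golden_iff[of "int p"]
    by (auto simp: phi_def phi_conj_def algebra_simps)
  have "phi_conj ^ p - (if e = 1 then phi_conj else phi)
      = Golden (int (fib (Suc p)) - (if e = 1 then 1 else 0)) (- (int (fib p) - e))"
    unfolding phi_conj_power using e(2) by (auto simp: phi_def phi_conj_def)
  then show "of_nat p dvd phi_conj ^ p - (if e = 1 then phi_conj else phi)"
    using 1 2 of_int_dvd_golden_iff[of "int p"] by (simp only: dvd_minus_iff of_int_of_nat_eq simp_thms)
qed

text \<open>Here F_(2p) = F_p (F_(p+1) + F_(p-1)). Cassini's identity eliminates the square of F_p,
  and the remaining difference factors as F_(p-e) times another multiple of p.\<close>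

lemma fib_double_prime_cong:
  assumes p: "prime p" "odd p" and e: "[5 ^ ((p - 1) div 2) = e] (mod int p)" "e \<in> {1, -1}"
  shows "int p dvd int (fib (nat (int p - e)))"
    and "int p ^ 2 dvd int (fib (2 * p)) - e * (1 + 3 * int (fib (nat (int p - e))))"
proof -
  obtain m where m: "p = Suc m" using prime_gt_0_nat[OF p(1)] by (cases p) auto
  have c: "coprime (int p) 2" by (simp add: p(2) coprime_commute)
  define f g where "f = int (fib p)" and "g = int (fib m)"
  have S: "int (fib (Suc p)) = f + g" by (simp add: f_def g_def m)
  have cassini: "(f + g) * g - f\<^sup>2 = - 1"
    using fib_Cassini_int[of m] p(2) by (simp add: f_def g_def m)
  have "2 * p = Suc (p + m)" by (simp add: m)
  then have "fib (2 * p) = fib (Suc m) * fib (Suc p) + fib m * fib p"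
    by (simp only: fib_add)
  then have "int (fib (2 * p)) = f * (f + g) + g * f"
    unfolding m[symmetric] by (simp only: of_nat_add of_nat_mult S f_def g_def)
  then have double: "int (fib (2 * p)) = f * (f + 2 * g)"
    by (simp add: algebra_simps)
  have 1: "int p dvd f - e"
    using fib_prime_cong(1)[OF p e(1)] by (simp add: cong_iff_dvd_diff f_def)
  have 2: "int p dvd 2 * (f + g) - (1 + e)"
    using fib_prime_cong(2)[OF p e(1)] by (simp add: cong_iff_dvd_diff flip: S)
  have "int p dvd int (fib (nat (int p - e)))
    \<and> int p ^ 2 dvd int (fib (2 * p)) - e * (1 + 3 * int (fib (nat (int p - e))))"
  proof (cases "e = 1")
    case True
    then have F: "int (fib (nat (int p - e))) = g" by (simp add: g_def m)
    have "int p dvd 2 * g" using dvd_diff[OF 2 dvd_mult[OF 1, of 2]] True by (simp add: algebra_simps)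
    then have g: "int p dvd g" using c coprime_dvd_mult_right_iff by blast
    have "f * (f + 2 * g) - (1 + 3 * g) = g * (3 * (f - 1) + g)"
      using cassini by (simp add: power2_eq_square algebra_simps)
    moreover have "int p * int p dvd g * (3 * (f - 1) + g)"
      using 1 g True by (intro mult_dvd_mono dvd_add dvd_mult) auto
    ultimately show ?thesis unfolding F double using True g by (simp add: power2_eq_square)
  next
    case False
    then have e': "e = - 1" using e(2) by simp
    then have "nat (int p - e) = Suc p" by simp
    then have F: "int (fib (nat (int p - e))) = f + g" by (simp only: S)
    have "int p dvd 2 * (f + g)" using 2 e' by simp
    then have h: "int p dvd f + g" using c coprime_dvd_mult_right_iff by blast
    have "f * (f + 2 * g) - e * (1 + 3 * (f + g)) = (f + g) * (3 * (f + 1) - (f + g))"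
      using cassini by (simp add: e' power2_eq_square algebra_simps)
    moreover have "int p * int p dvd (f + g) * (3 * (f + 1) - (f + g))"
      using 1 h e' by (intro mult_dvd_mono dvd_diff dvd_mult) auto
    ultimately show ?thesis unfolding F double using h by (simp only: power2_eq_square simp_thms)
  qed
  then show "int p dvd int (fib (nat (int p - e)))"
    and "int p ^ 2 dvd int (fib (2 * p)) - e * (1 + 3 * int (fib (nat (int p - e))))" by auto
qed

section \<open>Reduction from p^a to p and the first congruence\<close>

lemma binomial_sum_cong:
  fixes p a :: nat and e :: int
  assumes p: "prime p" "odd p" "p \<noteq> 5" and a: "a > 0"
    and e: "[5 ^ ((p - 1) div 2) = e] (mod int p)" "e \<in> {1, -1}"
  shows "int p ^ 2 dvd (\<Sum>k\<le>p ^ a - 1. int (p ^ a - 1 choose k) * int (2 * k choose k))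
    - e ^ a * (5 ^ (p - 1) - 3 * int (fib (nat (int p - e))))"
proof -
  \<comment> \<open>\<open>Q b\<close> is the value of \<open>sqrt5\<close> times the sum modulo p^2
    for the prime power p^b. Each step from b > 0 to b + 1 multiplies it by e.\<close>
  define Q where "Q b = 2 * sqrt5 ^ (p ^ b) - ((phi ^ 2) ^ (p ^ b) - (phi_conj ^ 2) ^ (p ^ b))" for b
  have Q_Suc: "of_nat p ^ 2 dvd Q (Suc b) - of_int e * Q b" if b: "b > 0" for b
  proof -
    note frob = golden_frobenius[OF p(1,2) e]
    define u v where "u = (if e = 1 then phi else phi_conj)" and "v = (if e = 1 then phi_conj else phi)"
    have "of_nat p dvd (phi ^ p) ^ 2 - u ^ 2" "of_nat p dvd (phi_conj ^ p) ^ 2 - v ^ 2"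
      using frob(2,3) unfolding u_def v_def by (intro dvd_power_diff; simp)+
    then have "of_nat p dvd (phi ^ 2) ^ p - u ^ 2" "of_nat p dvd (phi_conj ^ 2) ^ p - v ^ 2"
      by (simp_all add: mult.commute flip: power_mult)
    note lift = frob(1)[THEN dvd_power_prime_power_diff, OF b]
      this[THEN dvd_power_prime_power_diff, OF b]
    have "of_nat p ^ 2 dvd 2 * (sqrt5 ^ p ^ Suc b - (of_int e * sqrt5) ^ p ^ b)
        - (((phi ^ 2) ^ p ^ Suc b - (u ^ 2) ^ p ^ b) - ((phi_conj ^ 2) ^ p ^ Suc b - (v ^ 2) ^ p ^ b))"
      by (intro dvd_diff dvd_mult lift)
    \<comment> \<open>As p^b is odd, \<open>(e * sqrt5)^(p^b)\<close> yields a factor e; for e = -1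
      the swap of \<open>phi\<close> and \<open>phi_conj\<close> negates their difference.\<close>
    also have "\<dots> = Q (Suc b) - of_int e * Q b"
      using e(2) p(2) by (auto simp: Q_def u_def v_def algebra_simps)
    finally show ?thesis .
  qed
  have Q_pow: "of_nat p ^ 2 dvd Q (Suc b) - of_int (e ^ b) * Q 1" for b
  proof (induction b)
    case (Suc b)
    have "of_nat p ^ 2 dvd (Q (Suc (Suc b)) - of_int e * Q (Suc b))
        + of_int e * (Q (Suc b) - of_int (e ^ b) * Q 1)"
      using Suc by (intro dvd_add dvd_mult Q_Suc) simp_all
    then show ?case by (simp add: algebra_simps)
  qed simp
  obtain b where b: "a = Suc b" using a by (cases a) auto
  define h where "h = (5::int) ^ ((p - 1) div 2)"
  define T where "T = (\<Sum>k\<le>p ^ a - 1. int (p ^ a - 1 choose k) * int (2 * k choose k))"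
  have Q1: "Q 1 = of_int (2 * h - int (fib (2 * p))) * sqrt5"
    using phi_power_diff[of "2 * p"] 
    by (simp add: Q_def h_def sqrt5_power_odd[OF p(2)] left_diff_distrib flip: power_mult)
  have "of_nat p ^ 2 dvd sqrt5 * of_int T - Q a"
    using sqrt5_mult_binomial_sum_cong[OF p(1), of a] by (simp add: T_def Q_def)
  then have "of_nat p ^ 2 dvd (sqrt5 * of_int T - Q a) + (Q a - of_int (e ^ b) * Q 1)"
    using Q_pow[of b] unfolding b by (rule dvd_add)
  then have "of_int (int p ^ 2) dvd of_int (T - e ^ b * (2 * h - int (fib (2 * p)))) * sqrt5"
    unfolding Q1 by (simp add: algebra_simps)
  moreover have "coprime (int p ^ 2) 5"
  proof -
    have "coprime p 5" using p by (intro primes_coprime) auto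
    then show ?thesis using coprime_int_iff[of p 5] by simp
  qed
  ultimately have 1: "int p ^ 2 dvd T - e ^ b * (2 * h - int (fib (2 * p)))"
    using of_int_dvd_mult_sqrt5_iff by blast
  define F where "F = int (fib (nat (int p - e)))"
  have 2: "int p ^ 2 dvd int (fib (2 * p)) - e * (1 + 3 * F)"
    unfolding F_def using fib_double_prime_cong(2)[OF p(1,2) e] .
  \<comment> \<open>Since e^2 = 1, the vanishing of \<open>e * (h - e)^2\<close> modulo p^2 means
    that 2h is congruent to \<open>e * (h^2 + 1)\<close>. This produces the term 5^(p-1) =
    h^2.\<close>
  have "int p dvd h - e" using e(1) by (simp add: h_def cong_iff_dvd_diff)
  then have "int p ^ 2 dvd (h - e) ^ 2" by (rule dvd_power_same)
  then have 3: "int p ^ 2 dvd e * (h - e) ^ 2" by (rule dvd_mult)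
  have h2: "5 ^ (p - 1) = h ^ 2"
    using p(2) by (simp add: h_def flip: power_mult)
  have "(T - e ^ b * (2 * h - int (fib (2 * p))))
      - e ^ b * ((int (fib (2 * p)) - e * (1 + 3 * F)) + e * (h - e) ^ 2)
    = T - e ^ a * (5 ^ (p - 1) - 3 * F)"
    using e(2) unfolding h2 b by (auto simp: power2_eq_square algebra_simps)
  then have "int p ^ 2 dvd T - e ^ a * (5 ^ (p - 1) - 3 * F)"
    using dvd_diff[OF 1 dvd_mult[OF dvd_add[OF 2 3], of "e ^ b"]] by argo
  then show ?thesis unfolding T_def F_def .
qed

section \<open>Quadratic residues modulo 5\<close>

text \<open>As (5 - 1)/2 is even, reciprocity gives (5/p) = (p/5) without a sign; Euler's criterion
  for 5 modulo p does the rest.\<close>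

lemma Legendre_5_euler:
  assumes "prime p" "odd p" "p \<noteq> 5"
  shows "[5 ^ ((p - 1) div 2) = Legendre (int p) 5] (mod int p)"
    and "Legendre (int p) 5 \<in> {1, -1}"
proof -
  have p2: "2 < p" using assms prime_ge_2_nat[of p] by (cases "p = 2") auto
  have "Legendre (int p) 5 * Legendre 5 (int p) = 1"
    using Quadratic_Reciprocity[of p 5] assms p2 by simp
  then have *: "Legendre 5 (int p) = Legendre (int p) 5" "Legendre (int p) 5 \<noteq> 0"
    by (auto simp: Legendre_def split: if_splits)
  show "[5 ^ ((p - 1) div 2) = Legendre (int p) 5] (mod int p)"
    using euler_criterion[OF assms(1) p2, of 5] *(1) by (simp add: cong_sym)
  show "Legendre (int p) 5 \<in> {1, -1}"
    using *(2) by (auto simp: Legendre_def)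
qed

text \<open>By Euler's criterion the symbol of y is y^2 modulo 5, which is multiplicative, and -1,
  0, 1 are distinct modulo 5.\<close>

lemma Legendre_5_power:
  assumes "Legendre x 5 \<in> {1, -1}"
  shows "Legendre (x ^ n) 5 = Legendre x 5 ^ n"
proof -
  have euler: "[Legendre y 5 = y\<^sup>2] (mod 5)" for y
    using euler_criterion[of 5 y] by simp
  have "[Legendre (x ^ n) 5 = (x\<^sup>2) ^ n] (mod 5)"
    using euler[of "x ^ n"] by (simp add: mult.commute flip: power_mult)
  also have "[(x\<^sup>2) ^ n = Legendre x 5 ^ n] (mod 5)"
    by (intro cong_pow cong_sym[OF euler])
  finally have "[Legendre (x ^ n) 5 = Legendre x 5 ^ n] (mod 5)" .
  moreover have "Legendre x 5 ^ n \<in> {1, -1}"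
    using assms by (induction n) auto
  moreover have "Legendre (x ^ n) 5 \<in> {-1, 0, 1}"
    by (simp add: Legendre_def)
  ultimately show ?thesis
    by (elim insertE emptyE) (simp_all add: cong_def)
qed

section \<open>Fractions in the p-adic integers and the second sum\<close>

lemma p_integral_divide:
  assumes "coprime v (int p)"
  shows "p_integral p (of_int u / of_int v)"
proof (cases "v = 0")
  case True
  then show ?thesis using p_integral_of_int[of p 0] by simp
next
  case False
  obtain c d where cd: "quotient_of (of_int u / of_int v) = (c, d)" by fastforce
  then have "d > 0" "(of_int u / of_int v :: rat) = of_int c / of_int d" "coprime c d"
    using quotient_of_denom_pos quotient_of_div quotient_of_coprime by blast+
  then have "(of_int (u * d) :: rat) = of_int (c * v)"
    using False by (simp add: field_simps)
  then have "u * d = c * v" by (simp only: of_int_eq_iff)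
  then have "d dvd v"
    using \<open>coprime c d\<close> by (metis coprime_commute coprime_dvd_mult_right_iff dvd_triv_right)
  then show ?thesis
    using assms by (simp add: p_integral_def cd) (meson coprime_divisors dvd_refl)
qed

lemma padic_cong_divide:
  fixes u v w :: int
  assumes "coprime v (int p)" "v \<noteq> 0" "int m dvd u - v * w"
  shows "padic_cong p (of_int u / of_int v) (of_int w) m"
proof -
  obtain z where z: "u - v * w = int m * z" using assms(3) by (auto elim: dvdE)
  have "(of_int u / of_int v - of_int w :: rat) = of_int (u - v * w) / of_int v"
    using assms(2) by (simp add: field_simps)
  also have "\<dots> = of_nat m * (of_int z / of_int v)" by (simp add: z)
  finally show ?thesis
    unfolding padic_cong_def using p_integral_divide[OF assms(1)] p_integral_of_int by blast
qed

text \<open>An exact identity: \<open>(t - 1)^2 + 5t\<close> equals \<open>(t + 1)^2 + t\<close>, so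
  both sums come from the same coefficient, and 5^n / (-5)^k = (-1)^k 5^(n-k).\<close>

lemma sum_choose_divide_neg5:
  "(\<Sum>k\<le>n. of_nat (n choose k) * (of_nat (2 * k choose k) / (- 5) ^ k))
    = (\<Sum>k\<le>n. of_nat (n choose k) * of_nat (2 * k choose k)) / (5 ^ n :: rat)"
proof -
  have "[:- 1, 1:] ^ 2 + monom 5 1 = [:1, 1:] ^ 2 + monom (1::rat) 1"
    by (simp add: power2_eq_square monom_altdef)
  then have "(\<Sum>k\<le>n. of_nat (n choose k) * of_nat (2 * k choose k) * (- 1) ^ k * 5 ^ (n - k) :: rat)
      = (\<Sum>k\<le>n. of_nat (n choose k) * of_nat (2 * k choose k))"
    using coeff_shifted_square_pow[of "- 1 :: rat" 5 n] coeff_shifted_square_pow[of "1 :: rat" 1 n]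
    by simp
  moreover have "(\<Sum>k\<le>n. of_nat (n choose k) * of_nat (2 * k choose k) * (- 1) ^ k * 5 ^ (n - k) :: rat)
      = 5 ^ n * (\<Sum>k\<le>n. of_nat (n choose k) * (of_nat (2 * k choose k) / (- 5) ^ k))"
    unfolding sum_distrib_left
  proof (intro sum.cong refl)
    fix k assume "k \<in> {..n}"
    then have "(5 ^ n :: rat) = 5 ^ k * 5 ^ (n - k)" by (simp flip: power_add)
    moreover have "(- 5 :: rat) ^ k = (- 1) ^ k * 5 ^ k" by (simp flip: power_mult_distrib)
    moreover have "(- 1 :: rat) ^ k * (- 1) ^ k = 1" by (simp flip: power_mult_distrib)
    ultimately show "of_nat (n choose k) * of_nat (2 * k choose k) * (- 1) ^ k * 5 ^ (n - k)
      = (5 ^ n :: rat) * (of_nat (n choose k) * (of_nat (2 * k choose k) / (- 5) ^ k))"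
      by (simp add: field_simps)
  qed
  ultimately show ?thesis by (simp add: field_simps)
qed

lemma power_5_cong:
  assumes "prime p" "p \<noteq> 5" "a > 0"
  shows "int p dvd 5 ^ (p - 1) - 1" and "int p ^ 2 dvd 5 ^ (p ^ a - 1) - 5 ^ (p - 1)"
proof -
  have p: "p > 0" using assms(1) by (rule prime_gt_0_nat)
  have pow: "5 ^ m = 5 * (5::int) ^ (m - 1)" if "m > 0" for m
    using power_minus_mult[OF that, of "5::int"] by simp
  have five: "coprime p 5" using assms by (intro primes_coprime) auto
  then have "\<not> p dvd 5" using assms(1) by (metis coprime_absorb_left not_prime_unit)
  then have "[5 ^ (p - 1) = 1] (mod p)" using assms(1) by (rule fermat_theorem[rotated])
  then show 1: "int p dvd 5 ^ (p - 1) - 1"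
    using cong_int_iff[of "5 ^ (p - 1)" 1 p] by (simp add: cong_iff_dvd_diff)
  have "int p dvd 5 * (5 ^ (p - 1) - 1)" using 1 by (rule dvd_mult)
  also have "5 * (5 ^ (p - 1) - 1) = 5 ^ p - (5::int)"
    by (simp only: pow[OF p] right_diff_distrib mult_1_right)
  finally have step: "int p dvd 5 ^ p - 5" .
  \<comment> \<open>Lifting 5^p = 5 modulo p makes consecutive powers 5^(p^a) agree modulo p^2, down
    to 5^p.\<close>
  have "int p ^ 2 dvd 5 ^ p ^ a - 5 ^ p"
    using assms(3)
  proof (induction a)
    case (Suc a)
    show ?case
    proof (cases "a = 0")
      case False
      then have "int p ^ 2 dvd (5 ^ p ^ Suc a - 5 ^ p ^ a) + (5 ^ p ^ a - 5 ^ p)"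
        using dvd_power_prime_power_diff[of p "5::int" 5 a] step Suc by (intro dvd_add) auto
      then show ?thesis by simp
    qed simp
  qed simp
  also have "(5::int) ^ p ^ a - 5 ^ p = 5 * (5 ^ (p ^ a - 1) - 5 ^ (p - 1))"
    using p by (simp only: pow[of "p ^ a"] pow[of p] zero_less_power right_diff_distrib)
  finally have "int p ^ 2 dvd 5 * (5 ^ (p ^ a - 1) - 5 ^ (p - 1))" .
  moreover have "coprime (int p ^ 2) 5" using five coprime_int_iff[of p 5] by simp
  ultimately show "int p ^ 2 dvd 5 ^ (p ^ a - 1) - 5 ^ (p - 1)"
    using coprime_dvd_mult_right_iff by blast
qed

theorem corollary1p5:
  fixes p a :: nat
  assumes "prime p" and "p \<noteq> 2" and "p \<noteq> 5" and "a > 0"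
  shows "padic_cong p
           (\<Sum>k = 0..p ^ a - 1. of_nat ((p ^ a - 1) choose k) * of_nat ((2 * k) choose k))
           (of_int (jacobi (int (p ^ a)) 5)
              * (5 ^ (p - 1) - 3 * of_nat (fib (nat (int p - jacobi (int p) 5)))))
           (p ^ 2)
       \<and> padic_cong p
           (\<Sum>k = 0..p ^ a - 1. of_nat ((p ^ a - 1) choose k)
                                  * (of_nat ((2 * k) choose k) / (- 5) ^ k))
           (of_int (jacobi (int (p ^ a)) 5)
              * (1 - 3 * of_nat (fib (nat (int p - jacobi (int p) 5)))))
           (p ^ 2)"
proof -
  have odd: "odd p" using assms(1,2) primes_dvd_imp_eq[of 2 p] by auto
  define e F n where "e = Legendre (int p) 5" and "F = int (fib (nat (int p - e)))"
    and "n = p ^ a - 1"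
  note e = Legendre_5_euler[OF assms(1) odd assms(3), folded e_def]
  have jacobi: "jacobi (int p) 5 = e" "jacobi (int p ^ a) 5 = e ^ a"
    using Legendre_5_power[of "int p" a] e(2) by (simp_all add: jacobi_prime e_def)
  define T where "T = (\<Sum>k\<le>n. int (n choose k) * int (2 * k choose k))"
  have T: "int p ^ 2 dvd T - e ^ a * (5 ^ (p - 1) - 3 * F)"
    using binomial_sum_cong[OF assms(1) odd assms(3,4) e] by (simp add: T_def F_def n_def)
  have F: "int p dvd F"
    unfolding F_def by (rule fib_double_prime_cong(1)[OF assms(1) odd e])
  note five = power_5_cong[OF assms(1,3,4), folded n_def]
  \<comment> \<open>Both factors vanish modulo p, so 5^(p-1) - 3F is congruent to 5^(p-1) (1 - 3F)
    modulo p^2. Since 5^n is congruent to 5^(p-1), dividing T by 5^n leaves 1 - 3F.\<close>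
  have "int p * int p dvd F * (5 ^ (p - 1) - 1)"
    using F five(1) by (rule mult_dvd_mono)
  then have "int p ^ 2 dvd e ^ a * (3 * (F * (5 ^ (p - 1) - 1)))"
    by (simp add: power2_eq_square)
  then have "int p ^ 2 dvd (T - e ^ a * (5 ^ (p - 1) - 3 * F)) + e ^ a * (3 * (F * (5 ^ (p - 1) - 1)))
      - (5 ^ n - 5 ^ (p - 1)) * (e ^ a * (1 - 3 * F))"
    by (rule dvd_diff[OF dvd_add[OF T] dvd_mult2[OF five(2)]])
  also have "\<dots> = T - 5 ^ n * (e ^ a * (1 - 3 * F))"
    by (simp add: algebra_simps)
  finally have T': "int (p ^ 2) dvd T - 5 ^ n * (e ^ a * (1 - 3 * F))" by simp
  have "coprime p 5" using assms by (intro primes_coprime) auto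
  then have "coprime (5 ^ n) (int p)"
    using coprime_int_iff[of p 5] by (simp add: coprime_commute)
  then have "padic_cong p (of_int T / of_int (5 ^ n)) (of_int (e ^ a * (1 - 3 * F))) (p ^ 2)"
    using T' by (intro padic_cong_divide) simp_all
  moreover have "padic_cong p (of_int T) (of_int (e ^ a * (5 ^ (p - 1) - 3 * F))) (p ^ 2)"
    using T by (simp only: padic_cong_of_int_iff cong_iff_dvd_diff)
  ultimately show ?thesis
    using sum_choose_divide_neg5[of n]
    by (simp add: jacobi T_def F_def n_def atLeast0AtMost)
qed

end
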